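(* For every integer $n\ge 4$, $$red(n)=red(n-1)+red(n-2)+red(n-3)$$ and $$rod(n)=rod(n-1)+rod(n-2)+rod(n-3).$$
   Context: A partition is a finite, nonempty, nonincreasing sequence of positive integers called its parts. The perimeter of a partition $\pi$ is $\alpha_\pi+\lambda_\pi-1$, where $\alpha_\pi$ is the largest part of $\pi$ and $\lambda_\pi$ is the number of parts of $\pi$ (counted with multiplicity). $red(n)$ is the number of partitions of perimeter $n$ in which the even parts are distinct (no even part is repeated; odd parts are unrestricted), and $rod(n)$ is the number of partitions of perimeter $n$ in which the odd parts are distinct (no odd part is repeated; even parts are unrestricted). *)

theory Defs
  imports Main
begin

definition is_partition :: "nat list \<Rightarrow> bool" where
  "is_partition p \<longleftrightarrow> p \<noteq> [] \<and> sorted_wrt (\<ge>) p \<and> (\<forall>x\<in>set p. 0 < x)"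

(* The truncated subtraction is harmless: for a partition both summands are at least 1. *)
definition perimeter :: "nat list \<Rightarrow> nat" where
  "perimeter p = Max (set p) + length p - 1"

definition red :: "nat \<Rightarrow> nat" where
  "red n = card {p. is_partition p \<and> perimeter p = n \<and> distinct (filter even p)}"

definition rod :: "nat \<Rightarrow> nat" where
  "rod n = card {p. is_partition p \<and> perimeter p = n \<and> distinct (filter odd p)}"

(* Hence red and rod never take the cardinality of an infinite set. *)
lemma finite_partitions_of_perimeter: "finite {p. is_partition p \<and> perimeter p = n}"
proof (rule finite_subset)
  show "{p. is_partition p \<and> perimeter p = n} \<subseteq> {p. set p \<subseteq> {..n} \<and> length p \<le> n}"
  proof (intro subsetI CollectI conjI)
    fix p x
    assume "p \<in> {p. is_partition p \<and> perimeter p = n}"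
    then have p: "p \<noteq> []" "\<forall>x\<in>set p. 0 < x" and n: "Max (set p) + length p - 1 = n"
      by (auto simp: is_partition_def perimeter_def)
    have "Max (set p) \<in> set p" using p(1) by (intro Max_in) auto
    with p have "0 < Max (set p)" "0 < length p" by auto
    with n show "length p \<le> n" by linarith
    assume "x \<in> set p"
    then have "x \<le> Max (set p)" by simp
    with n \<open>0 < length p\<close> show "x \<in> {..n}" unfolding atMost_iff by linarith
  qed
qed (simp add: finite_lists_length_le)

end

theory Submission
  imports Defs
begin

text \<open>
  Both counts are instances of one problem: the parts satisfying a predicate \<open>R\<close> that alternates
  along the naturals must be distinct. Split the partitions of perimeter \<open>n\<close> into those whose
  largest part satisfies \<open>R\<close>, say \<open>d n\<close> of them, and the rest, say \<open>u n\<close> of them. The perimeter is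
  the largest part plus the number of remaining parts, so raising the largest part by one, or
  repeating it, adds 1 to the perimeter.

  If the largest part satisfies \<open>R\<close>, it occurs only once, so it can be lowered by one, and this
  loses no information: \<open>d n = u (n - 1)\<close> for \<open>n \<ge> 2\<close>. Otherwise compare the largest part \<open>k\<close> with the second
  one. Where they agree, delete one copy of \<open>k\<close>. Where the second is below \<open>k - 1\<close>, or absent, lower
  \<open>k\<close>. Where the second is \<open>k - 1\<close>, which satisfies \<open>R\<close>, lowering would repeat it; delete \<open>k\<close>
  instead, which lowers the perimeter by 2. Hence \<open>u n = u (n - 1) + d (n - 1) + d (n - 2)\<close>.
  Eliminating shows that \<open>u\<close> and \<open>d\<close>, and so also their sum, satisfy the tribonacci recurrence.
  The lemmas \<open>card_restricted_head\<close> and \<open>card_free_head\<close> are the two mutual recurrences.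
\<close>

lemma is_partition_Cons:
  "is_partition (a # q) \<longleftrightarrow> 0 < a \<and> (\<forall>x\<in>set q. 0 < x \<and> x \<le> a) \<and> sorted_wrt (\<ge>) q"
  by (auto simp: is_partition_def)

lemma perimeter_Cons:
  assumes "is_partition (a # q)"
  shows "perimeter (a # q) = a + length q"
proof -
  have "Max (set (a # q)) = a"
    using assms by (intro Max_eqI) (auto simp: is_partition_Cons)
  then show ?thesis by (simp add: perimeter_def)
qed

definition partitions_by_head :: "(nat \<Rightarrow> bool) \<Rightarrow> bool \<Rightarrow> nat \<Rightarrow> nat list set" where
  "partitions_by_head R b n =
     {p. is_partition p \<and> perimeter p = n \<and> distinct (filter R p) \<and> R (hd p) = b}"

lemma Cons_in_partitions_by_head:
  "a # q \<in> partitions_by_head R b n \<longleftrightarrow>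
     0 < a \<and> (\<forall>x\<in>set q. 0 < x \<and> x \<le> a) \<and> sorted_wrt (\<ge>) q \<and> a + length q = n
     \<and> (R a \<longrightarrow> a \<notin> set q) \<and> distinct (filter R q) \<and> R a = b"
  unfolding partitions_by_head_def
  using perimeter_Cons[of a q] by (auto simp: is_partition_Cons)

lemma partitions_by_head_cases:
  assumes "p \<in> partitions_by_head R b n"
  obtains a q where "p = a # q" "a # q \<in> partitions_by_head R b n"
  using assms by (cases p) (auto simp: partitions_by_head_def is_partition_def)

lemma finite_partitions_by_head: "finite (partitions_by_head R b n)"
  by (rule finite_subset[OF _ finite_partitions_of_perimeter[of n]])
     (auto simp: partitions_by_head_def)

lemma card_partitions_split:
  "card {p. is_partition p \<and> perimeter p = n \<and> distinct (filter R p)} =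
     card (partitions_by_head R False n) + card (partitions_by_head R True n)"
proof -
  have "{p. is_partition p \<and> perimeter p = n \<and> distinct (filter R p)} =
      partitions_by_head R False n \<union> partitions_by_head R True n"
    by (auto simp: partitions_by_head_def)
  moreover have "partitions_by_head R False n \<inter> partitions_by_head R True n = {}"
    by (auto simp: partitions_by_head_def)
  ultimately show ?thesis
    by (simp add: card_Un_disjoint finite_partitions_by_head)
qed

definition raise_head :: "nat list \<Rightarrow> nat list" where
  "raise_head p = Suc (hd p) # tl p"

lemma raise_head_Cons [simp]: "raise_head (a # q) = Suc a # q"
  by (simp add: raise_head_def)

lemma card_raise_head:
  "card (raise_head ` partitions_by_head R b n) = card (partitions_by_head R b n)"
proof (rule card_image, rule inj_onI)
  fix p p' assume p: "p \<in> partitions_by_head R b n" "p' \<in> partitions_by_head R b n"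
    and eq: "raise_head p = raise_head p'"
  obtain a q a' q' where "p = a # q" "p' = a' # q'"
    using p by (metis partitions_by_head_cases)
  with eq show "p = p'" by simp
qed

text \<open>
  The perimeter on the left is at least 2 because the partition consisting of the single part 1
  cannot be lowered.
\<close>
lemma restricted_head_eq:
  assumes alt: "\<And>k. R (Suc k) \<longleftrightarrow> \<not> R k"
  shows "partitions_by_head R True (n + 2) = raise_head ` partitions_by_head R False (n + 1)"
    (is "?L = ?Q")
proof (intro equalityI subsetI)
  fix p assume "p \<in> ?L"
  then obtain a q where p: "p = a # q" and aq: "a # q \<in> ?L"
    by (rule partitions_by_head_cases)
  have below: "0 < x \<and> x < a" if "x \<in> set q" for x
  proof -
    have "0 < x" "x \<le> a" "x \<noteq> a" using aq that by (auto simp: Cons_in_partitions_by_head)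
    then show ?thesis by simp
  qed
  have "1 < a"
  proof (cases q)
    case Nil
    then show ?thesis using aq by (simp add: Cons_in_partitions_by_head)
  next
    case (Cons x xs)
    then show ?thesis using below[of x] by simp
  qed
  then obtain k where k: "a = Suc k" "0 < k" by (cases a) auto
  have "k # q \<in> partitions_by_head R False (n + 1)"
    using aq below k alt[of k] by (auto simp: Cons_in_partitions_by_head less_Suc_eq_le)
  then show "p \<in> ?Q" using p k by (intro image_eqI[where x = "k # q"]) simp_all
next
  fix p assume "p \<in> ?Q"
  then obtain a q where p: "p = Suc a # q" and aq: "a # q \<in> partitions_by_head R False (n + 1)"
    by (elim imageE) (metis partitions_by_head_cases raise_head_Cons)
  then show "p \<in> ?L"
    using alt[of a] by (auto simp: Cons_in_partitions_by_head le_SucI)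
qed

lemma card_restricted_head:
  assumes "\<And>k. R (Suc k) \<longleftrightarrow> \<not> R k"
  shows "card (partitions_by_head R True (n + 2)) = card (partitions_by_head R False (n + 1))"
  by (simp only: restricted_head_eq[of R, OF assms] card_raise_head)

text \<open>
  The three pieces correspond to the second part being equal to the largest part, less than it by
  at least 2 (or absent), and less than it by exactly 1.
\<close>
lemma free_head_eq:
  assumes alt: "\<And>k. R (Suc k) \<longleftrightarrow> \<not> R k"
  shows "partitions_by_head R False (n + 2) =
    (\<lambda>p. hd p # p) ` partitions_by_head R False (n + 1)
    \<union> raise_head ` partitions_by_head R True (n + 1)
    \<union> (\<lambda>p. Suc (hd p) # p) ` partitions_by_head R True n"
    (is "?L = ?A \<union> ?B \<union> ?C")
proof (intro equalityI subsetI)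
  fix p assume "p \<in> ?L"
  then obtain a q where p: "p = a # q" and aq: "a # q \<in> ?L"
    by (rule partitions_by_head_cases)
  show "p \<in> ?A \<union> ?B \<union> ?C"
  proof (cases q)
    case Nil
    then obtain k where k: "a = Suc k" "0 < k"
      using aq by (cases a) (auto simp: Cons_in_partitions_by_head)
    then have "[k] \<in> partitions_by_head R True (n + 1)"
      using aq Nil alt[of k] by (auto simp: Cons_in_partitions_by_head)
    then have "p \<in> ?B" using p k Nil by (intro image_eqI[where x = "[k]"]) simp_all
    then show ?thesis by blast
  next
    case (Cons y ys)
    have "y \<le> a" "0 < y" using aq Cons by (auto simp: Cons_in_partitions_by_head)
    consider "y = a" | "Suc y = a" | "Suc y < a" using \<open>y \<le> a\<close> by linarith
    then show ?thesis
    proof cases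
      case 1
      then have "a # ys \<in> partitions_by_head R False (n + 1)"
        using aq Cons by (auto simp: Cons_in_partitions_by_head)
      then have "p \<in> ?A" using p Cons 1 by (intro image_eqI[where x = "a # ys"]) simp_all
      then show ?thesis by blast
    next
      case 2
      then have "y # ys \<in> partitions_by_head R True n"
        using aq Cons alt[of y] by (auto simp: Cons_in_partitions_by_head)
      then have "p \<in> ?C" using p Cons 2 by (intro image_eqI[where x = "y # ys"]) simp_all
      then show ?thesis by blast
    next
      case 3
      then obtain k where k: "a = Suc k" "y < k" by (cases a) auto
      have "x \<le> y" if "x \<in> set q" for x
        using aq Cons that by (auto simp: Cons_in_partitions_by_head)
      with k have below: "x < k" if "x \<in> set q" for x
        using that by (meson le_less_trans)
      have "k # q \<in> partitions_by_head R True (n + 1)"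
        using aq k below alt[of k] by (auto simp: Cons_in_partitions_by_head less_imp_le)
      then have "p \<in> ?B" using p k by (intro image_eqI[where x = "k # q"]) simp_all
      then show ?thesis by blast
    qed
  qed
next
  fix p assume "p \<in> ?A \<union> ?B \<union> ?C"
  then consider "p \<in> ?A" | "p \<in> ?B" | "p \<in> ?C" by blast
  then show "p \<in> ?L"
  proof cases
    case 1
    then obtain a q where "p = a # a # q" "a # q \<in> partitions_by_head R False (n + 1)"
      by (elim imageE) (metis partitions_by_head_cases list.sel(1) raise_head_Cons)
    then show ?thesis by (auto simp: Cons_in_partitions_by_head)
  next
    case 2
    then obtain a q where "p = Suc a # q" "a # q \<in> partitions_by_head R True (n + 1)"
      by (elim imageE) (metis partitions_by_head_cases list.sel(1) raise_head_Cons)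
    then show ?thesis
      using alt[of a] by (auto simp: Cons_in_partitions_by_head le_SucI)
  next
    case 3
    then obtain a q where "p = Suc a # a # q" "a # q \<in> partitions_by_head R True n"
      by (elim imageE) (metis partitions_by_head_cases list.sel(1) raise_head_Cons)
    then show ?thesis
      using alt[of a] by (auto simp: Cons_in_partitions_by_head le_SucI)
  qed
qed

lemma card_free_head:
  assumes alt: "\<And>k. R (Suc k) \<longleftrightarrow> \<not> R k"
  shows "card (partitions_by_head R False (n + 2)) =
    card (partitions_by_head R False (n + 1)) + card (partitions_by_head R True (n + 1))
    + card (partitions_by_head R True n)"
proof -
  let ?A = "(\<lambda>p. hd p # p) ` partitions_by_head R False (n + 1)"
  let ?B = "raise_head ` partitions_by_head R True (n + 1)"
  let ?C = "(\<lambda>p. Suc (hd p) # p) ` partitions_by_head R True n"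
  have fin: "finite ?A" "finite ?B" "finite ?C"
    by (simp_all add: finite_partitions_by_head)
  \<comment> \<open>A restricted largest part is not repeated, so raising it by one puts it
    at least 2 above the second part.\<close>
  have B: "hd (tl p) < hd p - 1" if mem: "p \<in> ?B" and tl: "tl p \<noteq> []" for p
  proof -
    obtain a q where p: "p = Suc a # q" and aq: "a # q \<in> partitions_by_head R True (n + 1)"
      using mem by (elim imageE) (metis partitions_by_head_cases raise_head_Cons)
    with tl p have "hd q \<in> set q" by simp
    with aq have "hd q \<le> a" "hd q \<noteq> a" by (auto simp: Cons_in_partitions_by_head)
    with p show ?thesis by simp
  qed
  have A: "tl p \<noteq> [] \<and> hd (tl p) = hd p" if "p \<in> ?A" for p
    using that by (auto simp: partitions_by_head_def is_partition_def)
  have C: "tl p \<noteq> [] \<and> Suc (hd (tl p)) = hd p" if "p \<in> ?C" for p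
    using that by (auto simp: partitions_by_head_def is_partition_def)
  have "?A \<inter> ?B = {}"
    using A B by fastforce
  moreover have "(?A \<union> ?B) \<inter> ?C = {}"
    using A B C by fastforce
  moreover have "card ?A = card (partitions_by_head R False (n + 1))"
    "card ?C = card (partitions_by_head R True n)"
    by (intro card_image inj_onI; simp)+
  ultimately show ?thesis
    by (simp only: free_head_eq[of R, OF alt] card_Un_disjoint fin finite_UnI card_raise_head)
qed

lemma tribonacci_of_alternating:
  assumes alt: "\<And>k. R (Suc k) \<longleftrightarrow> \<not> R k" and "n \<ge> 4"
  defines "t \<equiv> \<lambda>m. card {p. is_partition p \<and> perimeter p = m \<and> distinct (filter R p)}"
  shows "t n = t (n - 1) + t (n - 2) + t (n - 3)"
proof -
  obtain m where m: "n = m + 4" using \<open>n \<ge> 4\<close> by (metis add.commute le_Suc_ex)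
  define u d where "u k = card (partitions_by_head R False k)"
    and "d k = card (partitions_by_head R True k)" for k
  have t: "t k = u k + d k" for k
    by (simp add: t_def u_def d_def card_partitions_split)
  have d: "d (k + 2) = u (k + 1)" for k
    unfolding u_def d_def by (rule card_restricted_head[of R, OF alt])
  have u: "u (k + 2) = u (k + 1) + d (k + 1) + d k" for k
    unfolding u_def d_def by (rule card_free_head[of R, OF alt])
  have "u (m + 4) = u (m + 3) + d (m + 3) + d (m + 2)"
    "u (m + 3) = u (m + 2) + d (m + 2) + d (m + 1)"
    "d (m + 4) = u (m + 3)" "d (m + 3) = u (m + 2)" "d (m + 2) = u (m + 1)"
    using u[of "m + 2"] u[of "m + 1"] d[of "m + 2"] d[of "m + 1"] d[of m]
    by (simp_all add: eval_nat_numeral)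
  then have "t (m + 4) = t (m + 3) + t (m + 2) + t (m + 1)"
    unfolding t by linarith
  then show ?thesis
    by (simp add: m eval_nat_numeral)
qed

theorem mainTheorem7:
  fixes n :: nat
  assumes "n \<ge> 4"
  shows "red n = red (n - 1) + red (n - 2) + red (n - 3)
    \<and> rod n = rod (n - 1) + rod (n - 2) + rod (n - 3)"
  using tribonacci_of_alternating[of even n] tribonacci_of_alternating[of odd n] assms
  by (simp add: red_def rod_def)

end
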